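(* Let $A$ be a subset of $\omega^{\subseteq\omega}$. (1) If $\Delta(A)$ holds, then $\nabla(A)$ is monotonically normal and hereditarily paracompact. (2) If $\nabla(A)$ is monotonically normal and, whenever $\overline{x},\overline{y}\in\nabla(A)$ are compatible, $\overline{x}\wedge\overline{y}$ is in $\nabla(A)$, then $\Delta(A)$ holds.
   Context: Nabla product: $\square(\omega+1)^\omega$ is the set $(\omega+1)^\omega$ with base all boxes $\prod_n U_n$, $U_n$ open in $\omega+1$ (order topology); $x\sim y$ iff $\{n:x(n)\ne y(n)\}$ is finite; $\nabla(\omega+1)^\omega$ is the quotient space $\square(\omega+1)^\omega/\sim$. Partial functions: $\omega^{\subseteq\omega}$ is the set of all functions $x:N\to\omega$ with $N\subseteq\omega$ ($\operatorname{dom}x=N$), including the empty function, each identified with its graph. For $h\in\omega^\omega$, $x>^*h$ means $x(n)>h(n)$ for all but finitely many $n\in\operatorname{dom}x$. $x,y$ switch if $x\setminus y$ and $y\setminus x$ are infinite and $x(n)=y(n)$ for all but finitely many $n\in\operatorname{dom}x\cap\operatorname{dom}y$. $\Delta(A)$ is the statement: there exists $F:A\to\omega^\omega$ such that if $x,y\in A$ switch, then $x\setminus y\not>^*F(y)$ or $y\setminus x\not>^*F(x)$. Identification: for $x\in\omega^{\subseteq\omega}$ let $x'\in(\omega+1)^\omega$ extend $x$ with value $\omega$ outside $\operatorname{dom}x$, and let $\overline{x}=[x']_\sim$. $\nabla(A)$ is the subspace $\{\overline{x}:x\in A\}$ of $\nabla(\omega+1)^\omega$. Order: $\overline{y}\preceq\overline{x}$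 iff for all but finitely many $n\in\operatorname{dom}x$, $y(n)=x(n)$ (in particular $n \in \operatorname{dom} y$). $\overline{x},\overline{y}$ are compatible if they have a common $\preceq$-lower bound in $\nabla(\omega+1)^\omega$; in that case they have a greatest lower bound in $\nabla(\omega+1)^\omega$, denoted $\overline{x}\wedge\overline{y}$. A space $Y$ is monotonically normal if to every point $x$ and open $U\ni x$ there is assigned an open set $G(x,U)$ with $x\in G(x,U)\subseteq U$ such that $G(x,U)\cap G(y,V)\neq\emptyset$ implies $x\in V$ or $y\in U$. *)

theory Defs
  imports "HOL-Analysis.Analysis"
begin

text \<open>The quotient topology on the set of classes: a set of classes is open iff its union is.\<close>

definition quotient_topology :: "'a topology \<Rightarrow> ('a \<times> 'a) set \<Rightarrow> 'a set topology" where
  "quotient_topology X R = topology (\<lambda>\<U>. \<U> \<subseteq> topspace X // R \<and> openin X (\<Union>\<U>))"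

lemma openin_quotient_topology:
  assumes "equiv (topspace X) R"
  shows "openin (quotient_topology X R) \<U> \<longleftrightarrow> \<U> \<subseteq> topspace X // R \<and> openin X (\<Union>\<U>)"
proof -
  have Int: "\<Union>(\<U> \<inter> \<V>) = \<Union>\<U> \<inter> \<Union>\<V>"
    if "\<U> \<subseteq> topspace X // R" "\<V> \<subseteq> topspace X // R" for \<U> \<V>
  proof
    show "\<Union>\<U> \<inter> \<Union>\<V> \<subseteq> \<Union>(\<U> \<inter> \<V>)"
    proof
      fix x assume "x \<in> \<Union>\<U> \<inter> \<Union>\<V>"
      then obtain U V where UV: "U \<in> \<U>" "V \<in> \<V>" "x \<in> U" "x \<in> V" by blast
      then have "U = V" using quotient_disj[OF assms, of U V] that by blast
      then show "x \<in> \<Union>(\<U> \<inter> \<V>)" using UV by blast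
    qed
  qed blast
  have "istopology (\<lambda>\<U>. \<U> \<subseteq> topspace X // R \<and> openin X (\<Union>\<U>))"
    unfolding istopology_def
  proof (intro conjI allI impI)
    fix \<K> assume *: "\<forall>\<U>\<in>\<K>. \<U> \<subseteq> topspace X // R \<and> openin X (\<Union>\<U>)"
    then show "\<Union>\<K> \<subseteq> topspace X // R" by blast
    have "\<Union>(\<Union>\<K>) = \<Union>((\<lambda>\<U>. \<Union>\<U>) ` \<K>)" by blast
    moreover have "openin X (\<Union>((\<lambda>\<U>. \<Union>\<U>) ` \<K>))" using * by (intro openin_Union) blast
    ultimately show "openin X (\<Union>(\<Union>\<K>))" by simp
  qed (auto simp: Int openin_Int)
  then show ?thesis
    by (simp add: quotient_topology_def)
qed

lemma topspace_quotient_topology: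
  assumes "equiv (topspace X) R"
  shows "topspace (quotient_topology X R) = topspace X // R"
proof
  show "topspace (quotient_topology X R) \<subseteq> topspace X // R"
    using openin_quotient_topology[OF assms] openin_topspace by blast
  have "openin (quotient_topology X R) (topspace X // R)"
    by (simp add: openin_quotient_topology[OF assms] Union_quotient[OF assms])
  then show "topspace X // R \<subseteq> topspace (quotient_topology X R)"
    by (rule openin_subset)
qed

lemma quotient_map_quotient_topology:
  assumes "equiv (topspace X) R"
  shows "quotient_map X (quotient_topology X R) (\<lambda>x. R `` {x})"
  unfolding quotient_map_def topspace_quotient_topology[OF assms]
proof (intro conjI allI impI)
  show "(\<lambda>x. R `` {x}) ` topspace X = topspace X // R"
    by (auto simp: quotient_def)
  fix \<U> assume \<U>: "\<U> \<subseteq> topspace X // R"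
  have "{x \<in> topspace X. R `` {x} \<in> \<U>} = \<Union>\<U>"
  proof (intro set_eqI iffI)
    fix x assume "x \<in> {x \<in> topspace X. R `` {x} \<in> \<U>}"
    then show "x \<in> \<Union>\<U>" using equiv_class_self[OF assms] by blast
  next
    fix x assume "x \<in> \<Union>\<U>"
    then obtain U where U: "U \<in> \<U>" "x \<in> U" by blast
    then obtain y where y: "U = R `` {y}" "y \<in> topspace X" using \<U> by (blast elim: quotientE)
    with U have "(y, x) \<in> R" by simp
    then have "R `` {y} = R `` {x}" "x \<in> topspace X"
      using equiv_class_eq_iff[OF assms, of y x] by simp_all
    then show "x \<in> {x \<in> topspace X. R `` {x} \<in> \<U>}" using U y by simp
  qed
  then show "openin X {x \<in> topspace X. R `` {x} \<in> \<U>} \<longleftrightarrow> openin (quotient_topology X R) \<U>"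
    using \<U> by (simp add: openin_quotient_topology[OF assms])
qed

definition monotonically_normal_space :: "'a topology \<Rightarrow> bool" where
  "monotonically_normal_space X \<longleftrightarrow>
    (\<exists>G. (\<forall>x\<in>topspace X. \<forall>U. openin X U \<and> x \<in> U \<longrightarrow>
            openin X (G x U) \<and> x \<in> G x U \<and> G x U \<subseteq> U) \<and>
         (\<forall>x\<in>topspace X. \<forall>y\<in>topspace X. \<forall>U V.
            openin X U \<and> x \<in> U \<and> openin X V \<and> y \<in> V \<and> G x U \<inter> G y V \<noteq> {} \<longrightarrow>
            x \<in> V \<or> y \<in> U))"

text \<open>Paracompactness is understood to include the Hausdorff axiom.\<close>

definition paracompact_space :: "'a topology \<Rightarrow> bool" where
  "paracompact_space X \<longleftrightarrow> Hausdorff_space X \<and>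
    (\<forall>\<U>. (\<forall>U\<in>\<U>. openin X U) \<and> \<Union>\<U> = topspace X \<longrightarrow>
       (\<exists>\<V>. (\<forall>V\<in>\<V>. openin X V \<and> (\<exists>U\<in>\<U>. V \<subseteq> U)) \<and> \<Union>\<V> = topspace X \<and>
            locally_finite_in X \<V>))"

definition hereditarily_paracompact_space :: "'a topology \<Rightarrow> bool" where
  "hereditarily_paracompact_space X \<longleftrightarrow>
    (\<forall>S\<subseteq>topspace X. paracompact_space (subtopology X S))"

text \<open>The ordinal space \<open>\<omega> + 1\<close> is \<^typ>\<open>enat\<close>, which carries the order topology.\<close>

definition box_topology :: "(nat \<Rightarrow> enat) topology" where
  "box_topology = topology_generated_by {\<Pi> n\<in>UNIV. U n | U. \<forall>n. open (U n)}"

definition fin_diff :: "((nat \<Rightarrow> enat) \<times> (nat \<Rightarrow> enat)) set" where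
  "fin_diff = {(f, g). finite {n. f n \<noteq> g n}}"

definition nabla_space :: "(nat \<Rightarrow> enat) set topology" where
  "nabla_space = quotient_topology box_topology fin_diff"

lemma topspace_box_topology: "topspace box_topology = UNIV"
proof -
  have "UNIV \<in> {\<Pi> n\<in>UNIV. U n | U::nat \<Rightarrow> enat set. \<forall>n. open (U n)}"
    by (intro CollectI exI[of _ "\<lambda>_. UNIV"]) auto
  then show ?thesis
    by (auto simp: box_topology_def)
qed

lemma equiv_fin_diff: "equiv UNIV fin_diff"
proof (rule equivI)
  show "trans fin_diff"
  proof (rule transI)
    fix f g h assume "(f, g) \<in> fin_diff" "(g, h) \<in> fin_diff"
    then have "finite ({n. f n \<noteq> g n} \<union> {n. g n \<noteq> h n})" by (simp add: fin_diff_def)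
    then have "finite {n. f n \<noteq> h n}" by (rule rev_finite_subset) auto
    then show "(f, h) \<in> fin_diff" by (simp add: fin_diff_def)
  qed
next
  show "sym fin_diff"
    by (rule symI) (simp add: fin_diff_def eq_commute)
qed (auto simp: fin_diff_def refl_on_def)

lemma topspace_nabla_space: "topspace nabla_space = UNIV // fin_diff"
  by (simp add: nabla_space_def topspace_quotient_topology topspace_box_topology equiv_fin_diff)

text \<open>Partial functions from \<open>\<omega>\<close> to \<open>\<omega>\<close> have type \<^typ>\<open>nat \<rightharpoonup> nat\<close>.
  The restriction below has as its graph the difference of the two graphs.\<close>

definition pdiff :: "(nat \<rightharpoonup> nat) \<Rightarrow> (nat \<rightharpoonup> nat) \<Rightarrow> (nat \<rightharpoonup> nat)" where
  "pdiff x y = x |` {n. x n \<noteq> y n}"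

lemma graph_pdiff: "Map.graph (pdiff x y) = Map.graph x - Map.graph y"
  by (auto simp: pdiff_def Map.graph_def restrict_map_def split: if_splits)

definition gt_star :: "(nat \<rightharpoonup> nat) \<Rightarrow> (nat \<Rightarrow> nat) \<Rightarrow> bool" where
  "gt_star x h \<longleftrightarrow> finite {n \<in> dom x. \<not> the (x n) > h n}"

definition switches :: "(nat \<rightharpoonup> nat) \<Rightarrow> (nat \<rightharpoonup> nat) \<Rightarrow> bool" where
  "switches x y \<longleftrightarrow>
     infinite (Map.graph (pdiff x y)) \<and> infinite (Map.graph (pdiff y x)) \<and>
     finite {n \<in> dom x \<inter> dom y. x n \<noteq> y n}"

definition Delta :: "(nat \<rightharpoonup> nat) set \<Rightarrow> bool" where
  "Delta A \<longleftrightarrow>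
    (\<exists>F :: (nat \<rightharpoonup> nat) \<Rightarrow> (nat \<Rightarrow> nat). \<forall>x\<in>A. \<forall>y\<in>A. switches x y \<longrightarrow>
       \<not> gt_star (pdiff x y) (F y) \<or> \<not> gt_star (pdiff y x) (F x))"

definition extend :: "(nat \<rightharpoonup> nat) \<Rightarrow> (nat \<Rightarrow> enat)" where
  "extend x n = (case x n of None \<Rightarrow> \<infinity> | Some k \<Rightarrow> enat k)"

definition nabla_pt :: "(nat \<rightharpoonup> nat) \<Rightarrow> (nat \<Rightarrow> enat) set" where
  "nabla_pt x = fin_diff `` {extend x}"

definition nabla_sub :: "(nat \<rightharpoonup> nat) set \<Rightarrow> (nat \<Rightarrow> enat) set topology" where
  "nabla_sub A = subtopology nabla_space (nabla_pt ` A)"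

lemma extend_eq_iff: "extend x n = extend y n \<longleftrightarrow> x n = y n"
  by (auto simp: extend_def split: option.splits)

lemma nabla_pt_eq_iff: "nabla_pt x = nabla_pt y \<longleftrightarrow> finite {n. x n \<noteq> y n}"
  unfolding nabla_pt_def
  by (simp add: eq_equiv_class_iff[OF equiv_fin_diff]) (simp add: fin_diff_def extend_eq_iff)

lemma range_nabla_pt: "range nabla_pt = topspace nabla_space"
proof
  show "range nabla_pt \<subseteq> topspace nabla_space"
    by (auto simp: topspace_nabla_space nabla_pt_def quotientI)
  show "topspace nabla_space \<subseteq> range nabla_pt"
  proof
    fix c assume "c \<in> topspace nabla_space"
    then obtain f where f: "c = fin_diff `` {f}"
      by (auto simp: topspace_nabla_space elim: quotientE)
    have "f = extend (\<lambda>n. case f n of enat k \<Rightarrow> Some k | \<infinity> \<Rightarrow> None)"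
      by (rule ext) (auto simp: extend_def split: enat.splits)
    then have "c = nabla_pt (\<lambda>n. case f n of enat k \<Rightarrow> Some k | \<infinity> \<Rightarrow> None)"
      unfolding nabla_pt_def f by (rule arg_cong)
    then show "c \<in> range nabla_pt" by simp
  qed
qed

text \<open>\<open>nabla_le c d\<close> means that \<open>c\<close> lies below \<open>d\<close>; by \<open>nabla_le_iff\<close> it does not
  depend on the representatives.\<close>

definition nabla_le :: "(nat \<Rightarrow> enat) set \<Rightarrow> (nat \<Rightarrow> enat) set \<Rightarrow> bool" where
  "nabla_le c d \<longleftrightarrow>
    (\<exists>y x. c = nabla_pt y \<and> d = nabla_pt x \<and> finite {n \<in> dom x. y n \<noteq> x n})"

definition nabla_compatible :: "(nat \<Rightarrow> enat) set \<Rightarrow> (nat \<Rightarrow> enat) set \<Rightarrow> bool" where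
  "nabla_compatible c d \<longleftrightarrow>
    (\<exists>e\<in>topspace nabla_space. nabla_le e c \<and> nabla_le e d)"

definition is_nabla_meet ::
  "(nat \<Rightarrow> enat) set \<Rightarrow> (nat \<Rightarrow> enat) set \<Rightarrow> (nat \<Rightarrow> enat) set \<Rightarrow> bool" where
  "is_nabla_meet c d m \<longleftrightarrow> m \<in> topspace nabla_space \<and> nabla_le m c \<and> nabla_le m d \<and>
    (\<forall>e\<in>topspace nabla_space. nabla_le e c \<and> nabla_le e d \<longrightarrow> nabla_le e m)"

definition nabla_meet ::
  "(nat \<Rightarrow> enat) set \<Rightarrow> (nat \<Rightarrow> enat) set \<Rightarrow> (nat \<Rightarrow> enat) set" where
  "nabla_meet c d = (THE m. is_nabla_meet c d m)"

lemma nabla_le_iff: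
  "nabla_le (nabla_pt y) (nabla_pt x) \<longleftrightarrow> finite {n \<in> dom x. y n \<noteq> x n}"
proof
  assume "nabla_le (nabla_pt y) (nabla_pt x)"
  then obtain y' x' where "finite {n. y n \<noteq> y' n}" "finite {n. x n \<noteq> x' n}"
    "finite {n \<in> dom x'. y' n \<noteq> x' n}"
    unfolding nabla_le_def nabla_pt_eq_iff by blast
  then have "finite ({n. y n \<noteq> y' n} \<union> {n. x n \<noteq> x' n} \<union> {n \<in> dom x'. y' n \<noteq> x' n})"
    by simp
  then show "finite {n \<in> dom x. y n \<noteq> x n}"
    by (rule rev_finite_subset) (auto simp: dom_def)
qed (auto simp: nabla_le_def)

lemma nabla_le_antisym:
  assumes "nabla_le c d" "nabla_le d c"
  shows "c = d"
proof -
  obtain y x where yx: "c = nabla_pt y" "d = nabla_pt x"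
    using assms(1) by (auto simp: nabla_le_def)
  then have "finite ({n \<in> dom x. y n \<noteq> x n} \<union> {n \<in> dom y. x n \<noteq> y n})"
    using assms by (simp add: nabla_le_iff)
  moreover have "n \<in> {n \<in> dom x. y n \<noteq> x n} \<union> {n \<in> dom y. x n \<noteq> y n}" if "y n \<noteq> x n" for n
    using that by (cases "x n"; cases "y n") (simp_all add: domIff)
  then have "{n. y n \<noteq> x n} \<subseteq> {n \<in> dom x. y n \<noteq> x n} \<union> {n \<in> dom y. x n \<noteq> y n}"
    by (intro subsetI) (simp only: mem_Collect_eq)
  ultimately have "finite {n. y n \<noteq> x n}"
    by (rule rev_finite_subset)
  then show ?thesis by (simp add: yx nabla_pt_eq_iff)
qed

lemma is_nabla_meet_nabla_meet:
  assumes "nabla_compatible c d"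
  shows "is_nabla_meet c d (nabla_meet c d)"
proof -
  obtain e where e: "nabla_le e c" "nabla_le e d"
    using assms by (auto simp: nabla_compatible_def)
  obtain z x where z: "e = nabla_pt z" and c: "c = nabla_pt x"
    using e(1) by (auto simp: nabla_le_def)
  obtain y where d: "d = nabla_pt y"
    using e(2) by (auto simp: nabla_le_def)
  have "finite {n \<in> dom x. z n \<noteq> x n}" "finite {n \<in> dom y. z n \<noteq> y n}"
    using e by (simp_all add: z c d nabla_le_iff)
  then have "finite ({n \<in> dom x. z n \<noteq> x n} \<union> {n \<in> dom y. z n \<noteq> y n})" by simp
  then have "finite {n \<in> dom x. (x ++ y) n \<noteq> x n}"
    by (rule rev_finite_subset) (auto simp: map_add_def split: option.splits)
  moreover have "finite {n \<in> dom y. (x ++ y) n \<noteq> y n}"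
    by (rule finite_subset[of _ "{}"]) (auto simp: map_add_dom_app_simps)
  moreover have "nabla_le e (nabla_pt (x ++ y))"
    if "e \<in> topspace nabla_space" "nabla_le e c" "nabla_le e d" for e
  proof -
    obtain w where w: "e = nabla_pt w" using \<open>e \<in> topspace nabla_space\<close> range_nabla_pt by blast
    then have "finite ({n \<in> dom x. w n \<noteq> x n} \<union> {n \<in> dom y. w n \<noteq> y n})"
      using that c d by (simp add: nabla_le_iff)
    then have "finite {n \<in> dom (x ++ y). w n \<noteq> (x ++ y) n}"
      by (rule rev_finite_subset) (auto simp: map_add_def split: option.splits)
    then show ?thesis by (simp add: w nabla_le_iff)
  qed
  ultimately have m: "is_nabla_meet c d (nabla_pt (x ++ y))"
    by (simp add: is_nabla_meet_def c d nabla_le_iff flip: range_nabla_pt)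
  show ?thesis
    unfolding nabla_meet_def
  proof (rule theI[of "is_nabla_meet c d", OF m])
    fix m' assume m': "is_nabla_meet c d m'"
    show "m' = nabla_pt (x ++ y)"
    proof (rule nabla_le_antisym)
      show "nabla_le m' (nabla_pt (x ++ y))"
        using m m' by (simp add: is_nabla_meet_def)
      show "nabla_le (nabla_pt (x ++ y)) m'"
        using m m' by (simp add: is_nabla_meet_def)
    qed
  qed
qed

end

theory Submission
  imports Defs
begin

text \<open>
  The sets \<open>N(x, h)\<close> of all classes of \<open>y\<close> that extend \<open>x\<close> modulo finite with
  \<open>y - x >\<^sup>* h\<close> form a neighbourhood base at the class of \<open>x\<close>. If \<open>h \<ge> F x\<close> and
  \<open>g \<ge> F y\<close>, where \<open>F\<close> witnesses \<open>\<Delta>(A)\<close>, then \<open>N(x, h)\<close> and \<open>N(y, g)\<close> can only meet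
  if \<open>x\<close> and \<open>y\<close> do not switch, in which case one of the two points lies in the
  neighbourhood of the other. This gives monotone normality at once.

  For paracompactness, shrink a cover to such neighbourhoods \<open>N x\<close> and let \<open>below v x\<close> be the
  reflexive transitive closure of \<open>x \<in> N v\<close>. The points below a given point form a chain, and
  sets closed upwards are open. Given an upward closed set \<open>R\<close> still to be covered and a point
  \<open>x \<in> R\<close>, assign to each \<open>v \<in> R\<close> below \<open>x\<close> the set \<open>P v\<close> of those \<open>w \<in> N v\<close> for which
  \<open>v\<close> is the largest point below both \<open>x\<close> and \<open>w\<close>. These sets are disjoint, and what remains
  of \<open>R\<close> is again upward closed. They are open because every \<open>v'\<close> with
  \<open>z \<subseteq>\<^sup>* v' \<subseteq>\<^sup>* x\<close> takes its values from \<open>x\<close>, so \<open>N(z, h)\<close> with \<open>h \<ge> x\<close> contains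
  no extension of such a \<open>v'\<close> unless \<open>v' =\<^sup>* z\<close>.

  Conversely, monotone normality applied to the neighbourhoods \<open>N(x, 0)\<close> yields \<open>F\<close>: if
  \<open>x\<close> and \<open>y\<close> switch, then neither lies in the neighbourhood of the other, whereas a failure
  of \<open>\<Delta>(A)\<close> would put the meet of \<open>x\<close> and \<open>y\<close> into both shrunken neighbourhoods.
\<close>

section \<open>Basic neighbourhoods in the nabla product\<close>

text \<open>Where \<open>x n = None\<close> and \<open>y n = None\<close> the first disjunct holds
  already, so the arbitrary value \<open>the None\<close> never decides the condition.\<close>

definition near :: "(nat \<Rightarrow> nat) \<Rightarrow> (nat \<rightharpoonup> nat) \<Rightarrow> (nat \<rightharpoonup> nat) \<Rightarrow> bool" where
  "near h x y \<longleftrightarrow> (\<forall>\<^sub>F n in cofinite. y n = x n \<or> x n = None \<and> h n < the (y n))"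

definition nbhd :: "(nat \<Rightarrow> nat) \<Rightarrow> (nat \<rightharpoonup> nat) \<Rightarrow> (nat \<Rightarrow> enat) set set" where
  "nbhd h x = nabla_pt ` {y. near h x y}"

section \<open>Relations modulo finite as eventual statements\<close>

lemma nabla_pt_eq_cofinite: "nabla_pt x = nabla_pt y \<longleftrightarrow> (\<forall>\<^sub>F n in cofinite. x n = y n)"
  by (simp add: nabla_pt_eq_iff eventually_cofinite)

lemma nabla_le_cofinite:
  "nabla_le (nabla_pt y) (nabla_pt x) \<longleftrightarrow> (\<forall>\<^sub>F n in cofinite. x n = None \<or> y n = x n)"
  by (simp add: nabla_le_iff eventually_cofinite dom_def)

lemma gt_star_pdiff_cofinite:
  "gt_star (pdiff x y) h \<longleftrightarrow> (\<forall>\<^sub>F n in cofinite. x n = y n \<or> x n = None \<or> h n < the (x n))"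
proof -
  have "{n \<in> dom (pdiff x y). \<not> h n < the (pdiff x y n)} =
      {n. \<not> (x n = y n \<or> x n = None \<or> h n < the (x n))}"
    by (auto simp: pdiff_def restrict_map_def split: if_splits)
  then show ?thesis
    by (simp add: gt_star_def eventually_cofinite)
qed

lemma finite_graph_pdiff_cofinite:
  "finite (Map.graph (pdiff x y)) \<longleftrightarrow> (\<forall>\<^sub>F n in cofinite. x n = y n \<or> x n = None)"
proof -
  have dom: "dom (pdiff x y) = {n. \<not> (x n = y n \<or> x n = None)}"
    by (auto simp: pdiff_def restrict_map_def split: if_splits)
  have "Map.graph (pdiff x y) = (\<lambda>n. (n, the (pdiff x y n))) ` dom (pdiff x y)"
    by (force simp: Map.graph_def)
  moreover have "inj_on (\<lambda>n. (n, the (pdiff x y n))) (dom (pdiff x y))"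
    by (rule inj_onI) simp
  ultimately have "finite (Map.graph (pdiff x y)) \<longleftrightarrow> finite (dom (pdiff x y))"
    by (simp add: finite_image_iff)
  then show ?thesis
    by (simp add: dom eventually_cofinite)
qed

lemma switches_cofinite:
  "switches x y \<longleftrightarrow> \<not> (\<forall>\<^sub>F n in cofinite. x n = y n \<or> x n = None) \<and>
     \<not> (\<forall>\<^sub>F n in cofinite. y n = x n \<or> y n = None) \<and>
     (\<forall>\<^sub>F n in cofinite. x n = None \<or> y n = None \<or> x n = y n)"
proof -
  have "{n \<in> dom x \<inter> dom y. x n \<noteq> y n} = {n. \<not> (x n = None \<or> y n = None \<or> x n = y n)}"
    by auto
  then have "finite {n \<in> dom x \<inter> dom y. x n \<noteq> y n} \<longleftrightarrow>
      (\<forall>\<^sub>F n in cofinite. x n = None \<or> y n = None \<or> x n = y n)"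
    by (simp only: eventually_cofinite)
  then show ?thesis
    by (simp only: switches_def finite_graph_pdiff_cofinite)
qed

lemma nabla_le_trans:
  assumes "nabla_le c d" "nabla_le d e"
  shows "nabla_le c e"
proof -
  obtain x y z where c: "c = nabla_pt x" "d = nabla_pt y" "e = nabla_pt z"
    using assms by (metis nabla_le_def)
  have "\<forall>\<^sub>F n in cofinite. y n = None \<or> x n = y n" "\<forall>\<^sub>F n in cofinite. z n = None \<or> y n = z n"
    using assms by (simp_all add: c nabla_le_cofinite)
  then have "\<forall>\<^sub>F n in cofinite. z n = None \<or> x n = z n"
    by eventually_elim auto
  then show ?thesis
    by (simp add: c nabla_le_cofinite)
qed

lemma near_refl: "near h x x"
  by (simp add: near_def)

lemma near_cong:
  assumes "near h x y" "nabla_pt y = nabla_pt z"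
  shows "near h x z"
proof -
  have "\<forall>\<^sub>F n in cofinite. y n = x n \<or> x n = None \<and> h n < the (y n)"
    "\<forall>\<^sub>F n in cofinite. y n = z n"
    using assms by (simp_all add: near_def nabla_pt_eq_cofinite)
  then show ?thesis
    unfolding near_def by eventually_elim auto
qed

lemma near_trans:
  assumes "near h x y" "near h y z"
  shows "near h x z"
  using assms unfolding near_def by eventually_elim auto

lemma near_mono:
  assumes "near h x y" "\<And>n. g n \<le> h n"
  shows "near g x y"
  using assms(1) unfolding near_def
  by eventually_elim (use assms(2) order_le_less_trans in blast)

lemma nabla_pt_in_nbhd_iff [simp]: "nabla_pt y \<in> nbhd h x \<longleftrightarrow> near h x y"
  by (auto simp: nbhd_def intro: near_cong)

lemma nbhd_meetE:
  assumes "c \<in> nbhd h x" "c \<in> nbhd g y"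
  obtains z where "near h x z" "near g y z"
proof -
  obtain z where "c = nabla_pt z" using assms(1) by (auto simp: nbhd_def)
  then show ?thesis using that assms by simp
qed

lemma nbhd_mono: "(\<And>n. g n \<le> h n) \<Longrightarrow> nbhd h x \<subseteq> nbhd g x"
  by (auto simp: nbhd_def intro: near_mono)

lemma nbhd_subset_topspace: "nbhd h x \<subseteq> topspace nabla_space"
  by (auto simp: nbhd_def simp flip: range_nabla_pt)

lemma near_imp_nabla_le:
  assumes "near h x y"
  shows "nabla_le (nabla_pt y) (nabla_pt x)"
  using assms unfolding near_def nabla_le_cofinite by eventually_elim auto

section \<open>The box topology and its quotient\<close>

lemma openin_box_topology_Pi:
  assumes "\<And>n. open (U n)"
  shows "openin box_topology (\<Pi> n\<in>UNIV. U n)"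
  unfolding box_topology_def by (rule topology_generated_by_Basis) (use assms in blast)

text \<open>Boxes are closed under binary intersection, taken coordinatewise, so induction over the
  generation of the topology shows that they form a base.\<close>

lemma openin_box_topology_contains_box:
  assumes "openin box_topology W" "f \<in> W"
  obtains U :: "nat \<Rightarrow> enat set" where "\<And>n. open (U n)" "\<And>n. f n \<in> U n" "(\<Pi> n\<in>UNIV. U n) \<subseteq> W"
proof -
  have "generate_topology_on {\<Pi> n\<in>UNIV. U n | U::nat \<Rightarrow> enat set. \<forall>n. open (U n)} W"
    using assms(1) by (simp add: box_topology_def openin_topology_generated_by_iff)
  then have "\<exists>U. (\<forall>n. open (U n)) \<and> (\<forall>n. f n \<in> U n) \<and> (\<Pi> n\<in>UNIV. U n) \<subseteq> W"
    using assms(2)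
  proof (induction rule: generate_topology_on.induct)
    case (Int V W)
    then obtain U U' where "\<forall>n. open (U n)" "\<forall>n. f n \<in> U n" "(\<Pi> n\<in>UNIV. U n) \<subseteq> V"
      "\<forall>n. open (U' n)" "\<forall>n. f n \<in> U' n" "(\<Pi> n\<in>UNIV. U' n) \<subseteq> W"
      by blast
    then show ?case
      by (intro exI[of _ "\<lambda>n. U n \<inter> U' n"]) (auto simp: open_Int Pi_def subset_iff)
  next
    case (UN K)
    then show ?case by (meson Sup_upper UnionE subset_trans)
  qed (auto simp: Pi_def)
  then show ?thesis using that by blast
qed

lemma extend_surj: obtains y where "f = extend y"
proof
  show "f = extend (\<lambda>n. case f n of enat k \<Rightarrow> Some k | \<infinity> \<Rightarrow> None)"
    by (rule ext) (auto simp: extend_def split: enat.splits)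
qed

text \<open>Openness in the quotient comes down to openness of the union of the classes. As
  \<open>near\<close> ignores finite changes of its last argument, membership in this union can be
  tested on the point itself.\<close>

lemma Union_nbhd: "\<Union>(nbhd h x) = extend ` {y. near h x y}"
proof (intro set_eqI iffI)
  fix f assume "f \<in> \<Union>(nbhd h x)"
  then obtain y where y: "near h x y" "f \<in> nabla_pt y" by (auto simp: nbhd_def)
  obtain z where z: "f = extend z" by (rule extend_surj)
  have "(extend y, extend z) \<in> fin_diff" using y(2) by (simp add: nabla_pt_def z)
  then have "nabla_pt y = nabla_pt z"
    by (simp add: fin_diff_def extend_eq_iff nabla_pt_eq_iff)
  then show "f \<in> extend ` {y. near h x y}" using near_cong[OF y(1)] z by blast
next
  fix f assume "f \<in> extend ` {y. near h x y}"
  then show "f \<in> \<Union>(nbhd h x)"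
    by (auto simp: nbhd_def nabla_pt_def fin_diff_def)
qed

lemma openin_nbhd: "openin nabla_space (nbhd h x)"
proof -
  have "openin box_topology (\<Union>(nbhd h x))"
  proof (subst openin_subopen, intro ballI)
    fix f assume "f \<in> \<Union>(nbhd h x)"
    then obtain y where y: "near h x y" "f = extend y" by (auto simp: Union_nbhd)
    \<comment> \<open>Finite values are isolated points; at the other coordinates the box is the
      tail above \<open>h n\<close>, which is what \<open>near h y\<close> allows.\<close>
    define U where "U n = (case y n of None \<Rightarrow> {enat (h n)<..} | Some k \<Rightarrow> {enat k})" for n
    have "open (U n)" for n
      by (auto simp: U_def open_enat split: option.splits)
    then have "openin box_topology (\<Pi> n\<in>UNIV. U n)"
      by (rule openin_box_topology_Pi)
    moreover have "f \<in> (\<Pi> n\<in>UNIV. U n)"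
      by (auto simp: U_def y extend_def split: option.splits)
    moreover have "(\<Pi> n\<in>UNIV. U n) \<subseteq> \<Union>(nbhd h x)"
    proof
      fix g assume g: "g \<in> (\<Pi> n\<in>UNIV. U n)"
      obtain z where z: "g = extend z" by (rule extend_surj)
      have zU: "extend z n \<in> U n" for n using g z by auto
      have "near h y z"
        unfolding near_def
      proof (intro always_eventually allI)
        fix n show "z n = y n \<or> y n = None \<and> h n < the (z n)"
          using zU[of n] by (cases "y n"; cases "z n") (auto simp: U_def extend_def)
      qed
      then show "g \<in> \<Union>(nbhd h x)"
        using near_trans[OF y(1)] by (auto simp: Union_nbhd z)
    qed
    ultimately show "\<exists>T. openin box_topology T \<and> f \<in> T \<and> T \<subseteq> \<Union>(nbhd h x)"
      by blast
  qed
  moreover have "nbhd h x \<subseteq> topspace box_topology // fin_diff"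
    using nbhd_subset_topspace by (simp add: topspace_box_topology topspace_nabla_space)
  ultimately show ?thesis
    using openin_quotient_topology[of box_topology fin_diff]
    by (simp add: nabla_space_def topspace_box_topology equiv_fin_diff)
qed

lemma openin_nabla_space_contains_nbhd:
  assumes "openin nabla_space W" "nabla_pt x \<in> W"
  obtains h where "nbhd h x \<subseteq> W"
proof -
  have W: "W \<subseteq> UNIV // fin_diff" "openin box_topology (\<Union>W)"
    using assms(1) openin_quotient_topology[of box_topology fin_diff W]
    by (simp_all add: nabla_space_def topspace_box_topology equiv_fin_diff)
  have "extend x \<in> nabla_pt x"
    by (simp add: nabla_pt_def fin_diff_def)
  then have "extend x \<in> \<Union>W" using assms(2) by blast
  then obtain U where U: "\<And>n. open (U n)" "\<And>n. extend x n \<in> U n" "(\<Pi> n\<in>UNIV. U n) \<subseteq> \<Union>W"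
    using openin_box_topology_contains_box[OF W(2)] by blast
  \<comment> \<open>Where \<open>x n = None\<close>, the open set \<open>U n\<close> contains
    infinity and hence a tail. The implication leaves \<open>h\<close> arbitrary on
    \<open>dom x\<close>.\<close>
  have "\<exists>k. x n = None \<longrightarrow> {enat k<..} \<subseteq> U n" for n
    using U(1)[of n] U(2)[of n] by (auto simp: open_enat_iff extend_def)
  then obtain h where h: "\<And>n. x n = None \<Longrightarrow> {enat (h n)<..} \<subseteq> U n"
    by metis
  have "nabla_pt y \<in> W" if y: "near h x y" for y
  proof -
    \<comment> \<open>\<open>y\<close> may leave the box, but only at the finitely many coordinates
      excepted by \<open>near\<close>; resetting these to \<open>x n\<close> keeps the class and
      moves the point into the box.\<close>
    define z where "z n = (if y n = x n \<or> x n = None \<and> h n < the (y n) then y n else x n)" for n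
    have "extend z n \<in> U n" for n
      using U(2)[of n] h[of n]
      by (cases "x n"; cases "y n") (auto simp: z_def extend_def subset_iff)
    then have "extend z \<in> (\<Pi> n\<in>UNIV. U n)" by simp
    then have "extend z \<in> \<Union>W" using U(3) by (rule set_rev_mp)
    then obtain c where c: "c \<in> W" "extend z \<in> c" by blast
    have "c = nabla_pt z"
    proof -
      obtain f where "c = fin_diff `` {f}" using W(1) c(1) by (auto elim: quotientE)
      then show ?thesis
        using c(2) equiv_class_eq[OF equiv_fin_diff, of f "extend z"] by (simp add: nabla_pt_def)
    qed
    moreover have "\<forall>\<^sub>F n in cofinite. z n = y n"
      using y unfolding near_def by eventually_elim (auto simp: z_def)
    ultimately show ?thesis
      using c(1) by (simp flip: nabla_pt_eq_cofinite)
  qed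
  then have "nbhd h x \<subseteq> W" by (auto simp: nbhd_def)
  then show ?thesis using that by blast
qed

text \<open>At almost every \<open>n\<close> where \<open>v\<close> is defined,
  \<open>w n = v n = x n\<close> is at most \<open>h n\<close>. If \<open>z\<close> were undefined
  there, \<open>near h z w\<close> would force \<open>w n\<close> above \<open>h n\<close>.\<close>

lemma nbhd_separates_intermediate:
  assumes h: "\<And>n. n \<in> dom x \<Longrightarrow> the (x n) \<le> h n"
    and "near h z w" "nabla_le (nabla_pt v) (nabla_pt z)"
    and "nabla_le (nabla_pt x) (nabla_pt v)" "nabla_le (nabla_pt w) (nabla_pt v)"
  shows "nabla_pt v = nabla_pt z"
proof -
  have "\<forall>\<^sub>F n in cofinite. w n = z n \<or> z n = None \<and> h n < the (w n)"
    "\<forall>\<^sub>F n in cofinite. z n = None \<or> v n = z n" "\<forall>\<^sub>F n in cofinite. v n = None \<or> x n = v n"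
    "\<forall>\<^sub>F n in cofinite. v n = None \<or> w n = v n"
    using assms(2-) by (simp_all add: near_def nabla_le_cofinite)
  then have "\<forall>\<^sub>F n in cofinite. v n = z n"
  proof eventually_elim
    case (elim n)
    show ?case using elim h[of n] by (cases "v n") (auto simp: dom_def)
  qed
  then show ?thesis by (simp add: nabla_pt_eq_cofinite)
qed

lemma Hausdorff_nabla_space: "Hausdorff_space nabla_space"
  unfolding Hausdorff_space_def
proof (intro allI impI)
  fix c d assume cd: "c \<in> topspace nabla_space \<and> d \<in> topspace nabla_space \<and> c \<noteq> d"
  then obtain x y where xy: "c = nabla_pt x" "d = nabla_pt y"
    by (auto simp flip: range_nabla_pt)
  \<comment> \<open>Where just one of \<open>x\<close>, \<open>y\<close> is defined, a common
    extension would take a value both at most \<open>h n\<close> and above it. The arbitrary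
    \<open>the None\<close> can only enlarge \<open>h\<close>.\<close>
  define h where "h n = max (the (x n)) (the (y n))" for n
  have "False" if e: "e \<in> nbhd h x" "e \<in> nbhd h y" for e
  proof -
    obtain z where "near h x z" "near h y z"
      using e by (rule nbhd_meetE)
    then have "\<forall>\<^sub>F n in cofinite. x n = y n"
      unfolding near_def
    proof eventually_elim
      case (elim n)
      then show ?case by (auto simp: h_def)
    qed
    then show False using cd xy by (simp add: nabla_pt_eq_cofinite)
  qed
  then have "disjnt (nbhd h x) (nbhd h y)" by (auto simp: disjnt_def)
  then show "\<exists>U V. openin nabla_space U \<and> openin nabla_space V \<and> c \<in> U \<and> d \<in> V \<and> disjnt U V"
    using openin_nbhd near_refl xy by (metis nabla_pt_in_nbhd_iff)
qed

section \<open>Disjoint refinements from tree-like neighbourhood assignments\<close>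

text \<open>\<open>N_linked\<close> makes the points below a given one a chain, as in a forest.
  \<open>separated\<close> prevents the place where \<open>w\<close> branches off from
  \<open>x\<close> from moving above \<open>z\<close> while \<open>w\<close> stays close to
  \<open>z\<close>; this is what makes the pieces open.\<close>

lemma disjoint_open_refinement:
  fixes X :: "'a topology" and N :: "'a \<Rightarrow> 'a set" and le :: "'a \<Rightarrow> 'a \<Rightarrow> bool"
  assumes N_open: "\<And>x. x \<in> topspace X \<Longrightarrow> openin X (N x)"
    and N_refl: "\<And>x. x \<in> topspace X \<Longrightarrow> x \<in> N x"
    and N_linked: "\<And>x y z. \<lbrakk>x \<in> topspace X; y \<in> topspace X; z \<in> N x; z \<in> N y\<rbrakk> \<Longrightarrow> x \<in> N y \<or> y \<in> N x"
    and N_le: "\<And>x y. \<lbrakk>x \<in> topspace X; y \<in> N x\<rbrakk> \<Longrightarrow> le x y"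
    and le_trans: "\<And>x y z. le x y \<Longrightarrow> le y z \<Longrightarrow> le x z"
    and le_antisym: "\<And>x y. le x y \<Longrightarrow> le y x \<Longrightarrow> x = y"
    and separated: "\<And>x z. \<lbrakk>x \<in> topspace X; z \<in> topspace X\<rbrakk> \<Longrightarrow> \<exists>M. openin X M \<and> z \<in> M \<and>
        (\<forall>v\<in>topspace X. \<forall>w\<in>M. le z v \<and> le v x \<and> le v w \<longrightarrow> v = z)"
  obtains \<V> where "disjoint \<V>" "\<And>V. V \<in> \<V> \<Longrightarrow> openin X V \<and> (\<exists>x\<in>topspace X. V \<subseteq> N x)"
    "\<Union>\<V> = topspace X"
proof -
  let ?S = "topspace X"
  \<comment> \<open>The relation \<open>x \<in> N v\<close> need not be transitive, as the sizes of
    the neighbourhoods are unrelated. Its closure inherits antisymmetry from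
    \<open>le\<close>.\<close>
  define below where "below = (\<lambda>v x. v \<in> ?S \<and> x \<in> N v)\<^sup>*\<^sup>*"
  have N_sub: "N x \<subseteq> ?S" if "x \<in> ?S" for x
    using N_open[OF that] by (rule openin_subset)
  have below_refl: "below x x" for x
    by (simp add: below_def)
  have below_trans: "below x z" if "below x y" "below y z" for x y z
    using that by (simp add: below_def)
  have below_N: "below v x" if "v \<in> ?S" "x \<in> N v" for v x
    using that by (auto simp: below_def)
  have le_refl: "le x x" if "x \<in> ?S" for x
    using that N_refl N_le by blast
  have below_induct [consumes 1, case_names base step]: "Q x"
    if "below v x" "Q v" "\<And>y z. \<lbrakk>below v y; y \<in> ?S; z \<in> N y; Q y\<rbrakk> \<Longrightarrow> Q z" for Q v x
    using that(1) unfolding below_def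
    by (induction rule: rtranclp_induct) (use that(2,3) in \<open>auto simp: below_def\<close>)
  have below_top: "x \<in> ?S" if "below v x" "v \<in> ?S" for v x
    using that by (induction rule: below_induct) (use N_sub in blast)+
  have below_le: "le v x" if "below v x" "v \<in> ?S" for v x
    using that
  proof (induction rule: below_induct)
    case base
    then show ?case using le_refl by blast
  next
    case (step y z)
    then show ?case using N_le[of y z] le_trans[of v y z] by blast
  qed
  \<comment> \<open>Induction along the steps from \<open>v\<close> to \<open>x\<close>: at the last
    step \<open>N_linked\<close> either carries membership in \<open>N b\<close> one step down or
    places \<open>b\<close> above the predecessor.\<close>
  have below_N_comparable: "below v b \<or> v \<in> N b" if "below v x" "x \<in> N b" "b \<in> ?S" for v b x
    using that
  proof (induction rule: below_induct)
    case (step y z)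
    then consider "y \<in> N b" | "b \<in> N y" using N_linked[of y b z] by blast
    then show ?case
    proof cases
      case 2
      then show ?thesis using below_trans[of v y b] below_N[of y b] step by blast
    qed (use step in blast)
  qed blast
  have below_linear: "below v b \<or> below b v" if "below b x" "below v x" for v b x
    using that
  proof (induction rule: below_induct)
    case (step y z)
    then consider "below v y" | "v \<in> N y" using below_N_comparable[of v z y] by blast
    then show ?case
    proof cases
      case 2
      then show ?thesis using below_trans[of b y v] below_N[of y v] step by blast
    qed (use step in blast)
  qed blast
  have below_antisym: "v = w" if "below v w" "below w v" "v \<in> ?S" for v w
    using that below_top below_le le_antisym by blast
  have N_convex: "w \<in> N v" if "below v w" "below w z" "z \<in> N v" "v \<in> ?S" for v w z
    using below_N_comparable[of w z v] below_antisym[of v w] that N_refl by blast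
  \<comment> \<open>An uncovered part closed upwards under \<open>below\<close> stays so at limits, hence Zorn's lemma.\<close>
  define \<A> where "\<A> = {\<V>. disjoint \<V> \<and> (\<forall>V\<in>\<V>. openin X V \<and> (\<exists>x\<in>?S. V \<subseteq> N x)) \<and>
      (\<forall>w\<in>?S. \<forall>z\<in>\<Union>\<V>. below w z \<longrightarrow> w \<in> \<Union>\<V>)}"
  have "\<Union>\<C> \<in> \<A>" if \<C>: "subset.chain \<A> \<C>" for \<C>
  proof -
    have mem: "\<V> \<in> \<A>" if "\<V> \<in> \<C>" for \<V>
      using \<C> that by (auto simp: subset_chain_def)
    have "disjoint (\<Union>\<C>)"
    proof (rule disjointI)
      fix V W assume VW: "V \<in> \<Union>\<C>" "W \<in> \<Union>\<C>" "V \<noteq> W"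
      then obtain \<V> \<W> where "\<V> \<in> \<C>" "\<W> \<in> \<C>" "V \<in> \<V>" "W \<in> \<W>" by blast
      moreover have "\<V> \<subseteq> \<W> \<or> \<W> \<subseteq> \<V>" using \<C> calculation by (auto simp: subset_chain_def)
      ultimately obtain \<K> where "\<K> \<in> \<C>" "V \<in> \<K>" "W \<in> \<K>" by blast
      moreover have "disjoint \<K>" using mem[OF \<open>\<K> \<in> \<C>\<close>] by (simp add: \<A>_def)
      ultimately show "V \<inter> W = {}" using VW(3) by (simp add: disjointD)
    qed
    then show ?thesis using mem unfolding \<A>_def by blast
  qed
  then obtain \<V> where \<V>: "\<V> \<in> \<A>" and max: "\<And>\<W>. \<W> \<in> \<A> \<Longrightarrow> \<V> \<subseteq> \<W> \<Longrightarrow> \<W> = \<V>"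
    using subset_Zorn'[of \<A>] by metis
  have disj: "disjoint \<V>" and \<V>_open: "\<And>V. V \<in> \<V> \<Longrightarrow> openin X V"
    and \<V>_sub: "\<And>V. V \<in> \<V> \<Longrightarrow> \<exists>x\<in>?S. V \<subseteq> N x"
    and down: "\<And>w z. \<lbrakk>w \<in> ?S; z \<in> \<Union>\<V>; below w z\<rbrakk> \<Longrightarrow> w \<in> \<Union>\<V>"
    using \<V> by (auto simp: \<A>_def)
  have "x \<in> \<Union>\<V>" if x: "x \<in> ?S" for x
  proof (rule ccontr)
    assume xR: "x \<notin> \<Union>\<V>"
    \<comment> \<open>Covering only a neighbourhood of \<open>x\<close> could leave its predecessors
      uncovered. Adding pieces for all of \<open>B\<close> keeps the covered part closed
      downwards.\<close>
    define B where "B = {v \<in> ?S - \<Union>\<V>. below v x}"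
    define P where "P v = {w \<in> N v. \<forall>v'\<in>?S. below v v' \<and> below v' x \<and> below v' w \<longrightarrow> v' = v}" for v
    have BS: "v \<in> ?S" "v \<notin> \<Union>\<V>" "below v x" if "v \<in> B" for v
      using that by (auto simp: B_def)
    have P_open: "openin X (P v)" if v: "v \<in> B" for v
    proof (subst openin_subopen, intro ballI)
      fix z assume z: "z \<in> P v"
      then have zS: "z \<in> ?S" and zv: "z \<in> N v" using N_sub BS[OF v] by (auto simp: P_def)
      obtain M where M: "openin X M" "z \<in> M"
        "\<And>v w. \<lbrakk>v \<in> ?S; w \<in> M; le z v; le v x; le v w\<rbrakk> \<Longrightarrow> v = z"
        using separated[OF x zS] by blast
      \<comment> \<open>Any \<open>v'\<close> tested for \<open>w\<close> is comparable with
        \<open>z\<close>, as both lie below \<open>w\<close>. Below \<open>z\<close> the condition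
        for \<open>z\<close> applies; above \<open>z\<close> the choice of \<open>M\<close> forces
        \<open>v' = z\<close>.\<close>
      have "N v \<inter> N z \<inter> M \<subseteq> P v"
      proof
        fix w assume w: "w \<in> N v \<inter> N z \<inter> M"
        have "v' = v" if v': "v' \<in> ?S" "below v v'" "below v' x" "below v' w" for v'
        proof (cases "below v' z")
          case True
          then show ?thesis using z v' by (auto simp: P_def)
        next
          case False
          then have "below z v'"
            using below_linear[of z w v'] below_N[OF zS] w v' by blast
          then have "v' = z"
            using M(3) w v' below_le zS by blast
          then show ?thesis using False below_refl by blast
        qed
        then show "w \<in> P v" using w by (auto simp: P_def)
      qed
      moreover have "openin X (N v \<inter> N z \<inter> M)"
        using M(1) N_open zS BS[OF v] by (intro openin_Int) auto
      moreover have "z \<in> N v \<inter> N z \<inter> M"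
        using M(2) zv N_refl[OF zS] by blast
      ultimately show "\<exists>T. openin X T \<and> z \<in> T \<and> T \<subseteq> P v" by blast
    qed
    \<comment> \<open>Both \<open>v\<close> and \<open>v'\<close> lie below \<open>x\<close> and
      \<open>z\<close> and are comparable, so the condition for the smaller one identifies it with
      the larger.\<close>
    have P_disj: "v = v'" if "v \<in> B" "v' \<in> B" "z \<in> P v" "z \<in> P v'" for v v' z
    proof -
      have "below v z" "below v' z" using that BS below_N by (auto simp: P_def)
      moreover have "below v v' \<or> below v' v" using that BS below_linear by blast
      ultimately show ?thesis using that BS by (auto simp: P_def)
    qed
    \<comment> \<open>A covered point of \<open>P v\<close> lies above \<open>v\<close>, so downward
      closure would cover \<open>v\<close> as well.\<close>
    have P_R: "P v \<inter> \<Union>\<V> = {}" if "v \<in> B" for v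
      using down[OF BS(1)[OF that]] BS[OF that] below_N by (fastforce simp: P_def)
    have "\<V> \<union> P ` B \<in> \<A>"
      unfolding \<A>_def
    proof (intro CollectI conjI ballI impI)
      show "disjoint (\<V> \<union> P ` B)"
      proof (rule disjointI)
        fix V W assume VW: "V \<in> \<V> \<union> P ` B" "W \<in> \<V> \<union> P ` B" "V \<noteq> W"
        show "V \<inter> W = {}"
        proof (cases "V \<in> \<V>"; cases "W \<in> \<V>")
          assume "V \<in> \<V>" "W \<in> \<V>"
          then show ?thesis using disjointD[OF disj] VW(3) by blast
        next
          assume "V \<in> \<V>" "W \<notin> \<V>"
          then show ?thesis using P_R VW(2) by blast
        next
          assume "V \<notin> \<V>" "W \<in> \<V>"
          then show ?thesis using P_R VW(1) by blast
        next
          assume "V \<notin> \<V>" "W \<notin> \<V>"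
          then obtain v w where "v \<in> B" "w \<in> B" "V = P v" "W = P w" using VW by blast
          then show ?thesis using P_disj[of v w] VW(3) by blast
        qed
      qed
      show "openin X V" if "V \<in> \<V> \<union> P ` B" for V
        using that P_open \<V>_open by blast
      show "\<exists>x\<in>?S. V \<subseteq> N x" if V: "V \<in> \<V> \<union> P ` B" for V
      proof (cases "V \<in> \<V>")
        case False
        then obtain v where v: "v \<in> B" "V = P v" using V by blast
        then have "V \<subseteq> N v" by (auto simp: P_def)
        then show ?thesis using BS(1)[OF v(1)] by blast
      qed (use \<V>_sub in blast)
      fix w z assume w: "w \<in> ?S" and z: "z \<in> \<Union>(\<V> \<union> P ` B)" and wz: "below w z"
      show "w \<in> \<Union>(\<V> \<union> P ` B)"
      proof (rule ccontr)
        assume wn: "w \<notin> \<Union>(\<V> \<union> P ` B)"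
        then obtain v where v: "v \<in> B" "z \<in> P v" using down[OF w _ wz] z by blast
        then have "below v z" using BS below_N by (auto simp: P_def)
        \<comment> \<open>Between \<open>v\<close> and \<open>z\<close> the point \<open>w\<close>
          inherits membership in \<open>P v\<close> by convexity; below \<open>v\<close> it belongs
          to \<open>B\<close> and is covered by its own piece \<open>P w\<close>.\<close>
        then consider "below v w" | "below w v" using below_linear wz by blast
        then show False
        proof cases
          case 1
          then have "w \<in> N v" using N_convex v BS wz by (auto simp: P_def)
          moreover have "v' = v" if v': "v' \<in> ?S" "below v v'" "below v' x" "below v' w" for v'
          proof -
            have "below v' z" by (rule below_trans[OF v'(4) wz])
            then show ?thesis using v(2) v' unfolding P_def by blast
          qed
          ultimately have "w \<in> P v" unfolding P_def by blast
          then show False using wn v by blast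
        next
          case 2
          then have "below w x" using below_trans BS(3)[OF v(1)] by blast
          then have "w \<in> B" using wn w unfolding B_def by blast
          moreover have "w \<in> P w" using N_refl[OF w] below_antisym w unfolding P_def by blast
          ultimately show False using wn by blast
        qed
      qed
    qed
    then have "P ` B \<subseteq> \<V>" using max by blast
    moreover have "x \<in> B" using x xR below_refl by (simp add: B_def)
    moreover have "x \<in> P x" using N_refl[OF x] below_antisym x unfolding P_def by blast
    ultimately show False using xR by blast
  qed
  then have "\<Union>\<V> = ?S" using \<V>_open openin_subset by blast
  then show ?thesis using that disj \<V>_open \<V>_sub by blast
qed

section \<open>Monotone normality, paracompactness and \<open>\<Delta>(A)\<close>\<close>

text \<open>A common point extends both functions modulo finite, so almost all values of one outside
  the domain of the other exceed the other's height. This violates the condition on \<open>F\<close>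
  if they switch; otherwise one contains the other modulo finite, and the same bounds give
  \<open>near\<close>.\<close>

lemma Delta_nbhd_linked:
  assumes "switches x y \<longrightarrow> \<not> gt_star (pdiff x y) (F y) \<or> \<not> gt_star (pdiff y x) (F x)"
    and h: "\<And>n. F x n \<le> h n" and g: "\<And>n. F y n \<le> g n"
    and c: "c \<in> nbhd h x" "c \<in> nbhd g y"
  shows "nabla_pt y \<in> nbhd h x \<or> nabla_pt x \<in> nbhd g y"
proof -
  obtain z where z: "near h x z" "near g y z"
    using c by (rule nbhd_meetE)
  have agree: "\<forall>\<^sub>F n in cofinite. x n = None \<or> y n = None \<or> x n = y n"
    and xy: "\<forall>\<^sub>F n in cofinite. x n = y n \<or> x n = None \<or> y n = None \<and> g n < the (x n)"
    and yx: "\<forall>\<^sub>F n in cofinite. y n = x n \<or> y n = None \<or> x n = None \<and> h n < the (y n)"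
    using z unfolding near_def by (eventually_elim, auto)+
  have "gt_star (pdiff x y) (F y)"
    unfolding gt_star_pdiff_cofinite
    using xy by eventually_elim (use g order_le_less_trans in blast)
  moreover have "gt_star (pdiff y x) (F x)"
    unfolding gt_star_pdiff_cofinite
    using yx by eventually_elim (use h order_le_less_trans in blast)
  ultimately have "\<not> switches x y" using assms(1) by blast
  then consider "\<forall>\<^sub>F n in cofinite. x n = y n \<or> x n = None"
    | "\<forall>\<^sub>F n in cofinite. y n = x n \<or> y n = None"
    using agree by (auto simp: switches_cofinite)
  then show ?thesis
  proof cases
    case 1
    with yx have "near h x y" unfolding near_def by eventually_elim auto
    then show ?thesis by simp
  next
    case 2
    with xy have "near g y x" unfolding near_def by eventually_elim auto
    then show ?thesis by simp
  qed
qed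

lemma nbhd_refinement:
  assumes "openin nabla_space W" "nabla_pt x \<in> W"
  obtains h where "\<And>n. f n \<le> h n" "nbhd h x \<subseteq> W"
proof -
  obtain h where "nbhd h x \<subseteq> W"
    using openin_nabla_space_contains_nbhd assms by blast
  then have "nbhd (\<lambda>n. max (f n) (h n)) x \<subseteq> W"
    using nbhd_mono[of h "\<lambda>n. max (f n) (h n)" x] by auto
  then show ?thesis using that[of "\<lambda>n. max (f n) (h n)"] by auto
qed

text \<open>One assignment serves both conclusions. It gives more than monotone normality asks: one
  centre lies in the other neighbourhood, not merely in the open set that was shrunk.\<close>

lemma Delta_neighbourhood_assignment:
  assumes "Delta A"
  obtains N where
    "\<And>c W. \<lbrakk>c \<in> nabla_pt ` A; openin nabla_space W; c \<in> W\<rbrakk> \<Longrightarrow>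
      openin nabla_space (N c W) \<and> c \<in> N c W \<and> N c W \<subseteq> W \<and> (\<forall>d\<in>N c W. nabla_le d c)"
    "\<And>c d V W e. \<lbrakk>c \<in> nabla_pt ` A; d \<in> nabla_pt ` A; openin nabla_space V; c \<in> V;
      openin nabla_space W; d \<in> W; e \<in> N c V; e \<in> N d W\<rbrakk> \<Longrightarrow> c \<in> N d W \<or> d \<in> N c V"
proof -
  obtain F where F: "\<And>x y. \<lbrakk>x \<in> A; y \<in> A\<rbrakk> \<Longrightarrow> switches x y \<longrightarrow>
      \<not> gt_star (pdiff x y) (F y) \<or> \<not> gt_star (pdiff y x) (F x)"
    using assms by (auto simp: Delta_def)
  \<comment> \<open>\<open>F\<close> may differ between members of \<open>A\<close> with the same
    class, so one representative per class is fixed.\<close>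
  define r where "r c = (SOME x. x \<in> A \<and> nabla_pt x = c)" for c
  have r: "r c \<in> A \<and> nabla_pt (r c) = c" if "c \<in> nabla_pt ` A" for c
    unfolding r_def by (rule someI_ex[of "\<lambda>x. x \<in> A \<and> nabla_pt x = c"]) (use that in blast)
  define h where "h c W = (SOME h. (\<forall>n. F (r c) n \<le> h n) \<and> nbhd h (r c) \<subseteq> W)" for c W
  have h: "(\<forall>n. F (r c) n \<le> h c W n) \<and> nbhd (h c W) (r c) \<subseteq> W"
    if cW: "c \<in> nabla_pt ` A" "openin nabla_space W" "c \<in> W" for c W
    unfolding h_def
  proof (rule someI_ex[of "\<lambda>h. (\<forall>n. F (r c) n \<le> h n) \<and> nbhd h (r c) \<subseteq> W"])
    obtain h where "\<And>n. F (r c) n \<le> h n" "nbhd h (r c) \<subseteq> W"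
      by (rule nbhd_refinement[of W "r c" "F (r c)"]) (use r cW in auto)
    then show "\<exists>h. (\<forall>n. F (r c) n \<le> h n) \<and> nbhd h (r c) \<subseteq> W" by blast
  qed
  show ?thesis
  proof
    fix c W assume c: "c \<in> nabla_pt ` A" "openin nabla_space W" "c \<in> W"
    have "c \<in> nbhd (h c W) (r c)"
      using r[OF c(1)] near_refl nabla_pt_in_nbhd_iff by metis
    moreover have "nabla_le d c" if "d \<in> nbhd (h c W) (r c)" for d
      using that near_imp_nabla_le r[OF c(1)] by (force simp: nbhd_def)
    ultimately show "openin nabla_space (nbhd (h c W) (r c)) \<and> c \<in> nbhd (h c W) (r c) \<and>
        nbhd (h c W) (r c) \<subseteq> W \<and> (\<forall>d\<in>nbhd (h c W) (r c). nabla_le d c)"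
      using h[OF c] openin_nbhd by blast
  next
    fix c d V W e
    assume c: "c \<in> nabla_pt ` A" and d: "d \<in> nabla_pt ` A" and V: "openin nabla_space V" "c \<in> V"
      and W: "openin nabla_space W" "d \<in> W"
      and e: "e \<in> nbhd (h c V) (r c)" "e \<in> nbhd (h d W) (r d)"
    show "c \<in> nbhd (h d W) (r d) \<or> d \<in> nbhd (h c V) (r c)"
      using Delta_nbhd_linked[OF F[of "r c" "r d"] _ _ e] h[OF c V] h[OF d W] r[OF c] r[OF d]
      by metis
  qed
qed

section \<open>Monotone normality and paracompactness from \<open>Delta A\<close>\<close>

lemma Delta_imp_monotonically_normal:
  assumes "Delta A"
  shows "monotonically_normal_space (nabla_sub A)"
proof -
  obtain N where N:
    "\<And>c W. \<lbrakk>c \<in> nabla_pt ` A; openin nabla_space W; c \<in> W\<rbrakk> \<Longrightarrow>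
      openin nabla_space (N c W) \<and> c \<in> N c W \<and> N c W \<subseteq> W \<and> (\<forall>d\<in>N c W. nabla_le d c)"
    "\<And>c d V W e. \<lbrakk>c \<in> nabla_pt ` A; d \<in> nabla_pt ` A; openin nabla_space V; c \<in> V;
      openin nabla_space W; d \<in> W; e \<in> N c V; e \<in> N d W\<rbrakk> \<Longrightarrow> c \<in> N d W \<or> d \<in> N c V"
    by (fact Delta_neighbourhood_assignment[OF assms])
  \<comment> \<open>An open set of the subspace is extended to the whole space by a choice that
    depends on \<open>U\<close> alone.\<close>
  define w where "w U = (SOME W. openin nabla_space W \<and> U = W \<inter> nabla_pt ` A)" for U
  have w: "openin nabla_space (w U) \<and> U = w U \<inter> nabla_pt ` A" if "openin (nabla_sub A) U" for U
    unfolding w_def by (rule someI_ex[of "\<lambda>W. openin nabla_space W \<and> U = W \<inter> nabla_pt ` A"])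
      (use that in \<open>simp add: nabla_sub_def openin_subtopology\<close>)
  have top: "topspace (nabla_sub A) = nabla_pt ` A"
    using range_nabla_pt by (auto simp: nabla_sub_def)
  show ?thesis
    unfolding monotonically_normal_space_def top
  proof (rule exI[of _ "\<lambda>c U. N c (w U) \<inter> nabla_pt ` A"], intro conjI ballI allI impI)
    fix c U assume "c \<in> nabla_pt ` A" and U: "openin (nabla_sub A) U \<and> c \<in> U"
    then have "openin nabla_space (N c (w U)) \<and> c \<in> N c (w U) \<and> N c (w U) \<subseteq> w U"
      using N(1)[of c "w U"] w[of U] by blast
    then show "openin (nabla_sub A) (N c (w U) \<inter> nabla_pt ` A)"
      "c \<in> N c (w U) \<inter> nabla_pt ` A" "N c (w U) \<inter> nabla_pt ` A \<subseteq> U"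
      using w[of U] U \<open>c \<in> nabla_pt ` A\<close> by (auto simp: nabla_sub_def openin_subtopology)
  next
    fix c d U V
    assume cd: "c \<in> nabla_pt ` A" "d \<in> nabla_pt ` A"
      and UV: "openin (nabla_sub A) U \<and> c \<in> U \<and> openin (nabla_sub A) V \<and> d \<in> V \<and>
        N c (w U) \<inter> nabla_pt ` A \<inter> (N d (w V) \<inter> nabla_pt ` A) \<noteq> {}"
    then have "c \<in> N d (w V) \<or> d \<in> N c (w U)"
      using N(2)[OF cd, of "w U" "w V"] w[of U] w[of V] by blast
    then show "c \<in> V \<or> d \<in> U"
      using N(1)[of c "w U"] N(1)[of d "w V"] w[of U] w[of V] cd UV by blast
  qed
qed

lemma paracompact_space_disjoint_refinement:
  assumes "Hausdorff_space X"
    and refine: "\<And>\<U>. \<lbrakk>\<And>U. U \<in> \<U> \<Longrightarrow> openin X U; \<Union>\<U> = topspace X\<rbrakk> \<Longrightarrow>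
      \<exists>\<V>. disjoint \<V> \<and> (\<forall>V\<in>\<V>. openin X V \<and> (\<exists>U\<in>\<U>. V \<subseteq> U)) \<and> \<Union>\<V> = topspace X"
  shows "paracompact_space X"
  unfolding paracompact_space_def
proof (intro conjI allI impI assms(1))
  fix \<U> assume "(\<forall>U\<in>\<U>. openin X U) \<and> \<Union>\<U> = topspace X"
  then have "\<exists>\<V>. disjoint \<V> \<and> (\<forall>V\<in>\<V>. openin X V \<and> (\<exists>U\<in>\<U>. V \<subseteq> U)) \<and> \<Union>\<V> = topspace X"
    by (intro refine) auto
  then obtain \<V> where \<V>: "disjoint \<V>" "\<forall>V\<in>\<V>. openin X V \<and> (\<exists>U\<in>\<U>. V \<subseteq> U)" "\<Union>\<V> = topspace X"
    by (elim exE conjE)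
  \<comment> \<open>A member of a disjoint family meets no other member, so it witnesses local
    finiteness at each of its points.\<close>
  have "finite {U \<in> \<V>. U \<inter> V \<noteq> {}}" if "V \<in> \<V>" for V
    by (rule finite_subset[of _ "{V}"]) (use disjointD[OF \<V>(1)] that in auto)
  then have "\<exists>V. openin X V \<and> x \<in> V \<and> finite {U \<in> \<V>. U \<inter> V \<noteq> {}}" if "x \<in> topspace X" for x
    using \<V>(2,3) that by (metis Union_iff)
  then have "locally_finite_in X \<V>"
    by (simp add: locally_finite_in_def \<V>(3))
  then show "\<exists>\<V>. (\<forall>V\<in>\<V>. openin X V \<and> (\<exists>U\<in>\<U>. V \<subseteq> U)) \<and> \<Union>\<V> = topspace X \<and>
      locally_finite_in X \<V>"
    using \<V> by blast
qed

text \<open>The neighbourhood properties survive tracing on \<open>S\<close>, so arbitrary subspaces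
  are treated directly.\<close>

lemma Delta_imp_paracompact:
  assumes "Delta A" and S: "S \<subseteq> nabla_pt ` A"
  shows "paracompact_space (subtopology nabla_space S)"
proof (rule paracompact_space_disjoint_refinement)
  let ?X = "subtopology nabla_space S"
  show "Hausdorff_space ?X"
    by (rule Hausdorff_space_subtopology[OF Hausdorff_nabla_space])
  have top: "topspace ?X = S"
    using S range_nabla_pt by auto
  obtain N where N:
    "\<And>c W. \<lbrakk>c \<in> nabla_pt ` A; openin nabla_space W; c \<in> W\<rbrakk> \<Longrightarrow>
      openin nabla_space (N c W) \<and> c \<in> N c W \<and> N c W \<subseteq> W \<and> (\<forall>d\<in>N c W. nabla_le d c)"
    "\<And>c d V W e. \<lbrakk>c \<in> nabla_pt ` A; d \<in> nabla_pt ` A; openin nabla_space V; c \<in> V;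
      openin nabla_space W; d \<in> W; e \<in> N c V; e \<in> N d W\<rbrakk> \<Longrightarrow> c \<in> N d W \<or> d \<in> N c V"
    by (fact Delta_neighbourhood_assignment[OF assms(1)])
  fix \<U> assume \<U>: "\<And>U. U \<in> \<U> \<Longrightarrow> openin ?X U" "\<Union>\<U> = topspace ?X"
  have "\<forall>c\<in>S. \<exists>W. openin nabla_space W \<and> c \<in> W \<and> (\<exists>U\<in>\<U>. W \<inter> S \<subseteq> U)"
  proof
    fix c assume "c \<in> S"
    then obtain U where "U \<in> \<U>" "c \<in> U" using \<U>(2) top by blast
    then show "\<exists>W. openin nabla_space W \<and> c \<in> W \<and> (\<exists>U\<in>\<U>. W \<inter> S \<subseteq> U)"
      using \<U>(1)[of U] by (auto simp: openin_subtopology)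
  qed
  then obtain w where w: "\<And>c. c \<in> S \<Longrightarrow> openin nabla_space (w c)" "\<And>c. c \<in> S \<Longrightarrow> c \<in> w c"
    "\<And>c. c \<in> S \<Longrightarrow> \<exists>U\<in>\<U>. w c \<inter> S \<subseteq> U"
    by metis
  have Nw: "openin nabla_space (N c (w c)) \<and> c \<in> N c (w c) \<and> N c (w c) \<subseteq> w c \<and>
      (\<forall>d\<in>N c (w c). nabla_le d c)" if "c \<in> S" for c
    using that S by (intro N(1) w(1,2)) auto
  obtain \<V> where \<V>: "disjoint \<V>"
    "\<And>V. V \<in> \<V> \<Longrightarrow> openin ?X V \<and> (\<exists>c\<in>topspace ?X. V \<subseteq> N c (w c) \<inter> S)" "\<Union>\<V> = topspace ?X"
  \<comment> \<open>The order is \<open>nabla_le\<close> reversed, that is, inclusion modulo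
    finite.\<close>
  proof (rule disjoint_open_refinement[of ?X "\<lambda>c. N c (w c) \<inter> S" "\<lambda>c d. nabla_le d c"],
      unfold top)
    fix c assume "c \<in> S"
    then show "openin ?X (N c (w c) \<inter> S)" "c \<in> N c (w c) \<inter> S"
      using Nw by (auto simp: openin_subtopology)
  next
    fix c d e assume "c \<in> S" "d \<in> S" "e \<in> N c (w c) \<inter> S" "e \<in> N d (w d) \<inter> S"
    then show "c \<in> N d (w d) \<inter> S \<or> d \<in> N c (w c) \<inter> S"
      using N(2)[of c d "w c" "w d" e] w(1,2) S by blast
  next
    fix c d assume "c \<in> S" "d \<in> N c (w c) \<inter> S"
    then show "nabla_le d c" using Nw by blast
  next
    fix c d e assume "nabla_le d c" "nabla_le e d"
    then show "nabla_le e c" using nabla_le_trans by blast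
  next
    fix c d assume "nabla_le d c" "nabla_le c d"
    then show "c = d" using nabla_le_antisym by blast
  next
    fix c d assume "c \<in> S" "d \<in> S"
    then obtain x z where xz: "c = nabla_pt x" "d = nabla_pt z" using S by blast
    let ?M = "nbhd (\<lambda>n. the (x n)) z"
    have "u = d"
      if u: "u \<in> S" and v: "v \<in> ?M" and le: "nabla_le u d" "nabla_le c u" "nabla_le v u" for u v
    proof -
      obtain y where y: "u = nabla_pt y" using u S by blast
      obtain y' where "v = nabla_pt y'" "near (\<lambda>n. the (x n)) z y'"
        using v by (auto simp: nbhd_def)
      then show ?thesis
        using nbhd_separates_intermediate[of x "\<lambda>n. the (x n)" z y' y] le xz y by simp
    qed
    moreover have "openin ?X (?M \<inter> S)" "d \<in> ?M \<inter> S"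
      using openin_nbhd near_refl xz \<open>d \<in> S\<close> by (auto simp: openin_subtopology)
    ultimately show "\<exists>M. openin ?X M \<and> d \<in> M \<and>
        (\<forall>v\<in>S. \<forall>e\<in>M. nabla_le v d \<and> nabla_le c v \<and> nabla_le e v \<longrightarrow> v = d)"
      by blast
  next
    fix \<V> assume "disjoint \<V>" "\<Union>\<V> = S"
      "\<And>V. V \<in> \<V> \<Longrightarrow> openin ?X V \<and> (\<exists>c\<in>S. V \<subseteq> N c (w c) \<inter> S)"
    then show thesis by (intro that) (simp_all only: top)
  qed
  have "\<exists>U\<in>\<U>. V \<subseteq> U" if V: "V \<in> \<V>" for V
  proof -
    obtain c where "c \<in> S" "V \<subseteq> N c (w c) \<inter> S" using \<V>(2)[OF V] top by blast
    then show ?thesis using w(3)[of c] Nw[of c] by blast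
  qed
  then show "\<exists>\<V>. disjoint \<V> \<and> (\<forall>V\<in>\<V>. openin ?X V \<and> (\<exists>U\<in>\<U>. V \<subseteq> U)) \<and> \<Union>\<V> = topspace ?X"
    using \<V> by blast
qed

lemma Delta_imp_hereditarily_paracompact:
  assumes "Delta A"
  shows "hereditarily_paracompact_space (nabla_sub A)"
  unfolding hereditarily_paracompact_space_def
proof (intro allI impI)
  fix S assume "S \<subseteq> topspace (nabla_sub A)"
  then have "S \<subseteq> nabla_pt ` A" by (simp add: nabla_sub_def)
  then show "paracompact_space (subtopology (nabla_sub A) S)"
    using Delta_imp_paracompact[OF assms]
    by (simp add: nabla_sub_def subtopology_subtopology Int_absorb1)
qed

section \<open>\<open>Delta A\<close> from monotone normality and meets\<close>

lemma monotonically_normal_imp_Delta: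
  assumes "monotonically_normal_space (nabla_sub A)"
    and meet: "\<And>c d. \<lbrakk>c \<in> nabla_pt ` A; d \<in> nabla_pt ` A; nabla_compatible c d\<rbrakk> \<Longrightarrow>
      nabla_meet c d \<in> nabla_pt ` A"
  shows "Delta A"
proof -
  have top: "topspace (nabla_sub A) = nabla_pt ` A"
    using range_nabla_pt by (auto simp: nabla_sub_def)
  obtain G where
    G: "\<forall>c\<in>nabla_pt ` A. \<forall>U. openin (nabla_sub A) U \<and> c \<in> U \<longrightarrow>
        openin (nabla_sub A) (G c U) \<and> c \<in> G c U \<and> G c U \<subseteq> U" and
    G_meet: "\<forall>c\<in>nabla_pt ` A. \<forall>d\<in>nabla_pt ` A. \<forall>U V.
        openin (nabla_sub A) U \<and> c \<in> U \<and> openin (nabla_sub A) V \<and> d \<in> V \<and> G c U \<inter> G d V \<noteq> {} \<longrightarrow>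
        c \<in> V \<or> d \<in> U"
    using assms(1) unfolding monotonically_normal_space_def top by (elim exE conjE)
  \<comment> \<open>Only inclusion modulo finite is extracted from these sets; the height
    \<open>0\<close> is an arbitrary choice.\<close>
  define U where "U x = nbhd (\<lambda>_. 0) x \<inter> nabla_pt ` A" for x
  have U_open: "openin (nabla_sub A) (U x)" for x
    using openin_nbhd by (auto simp: U_def nabla_sub_def openin_subtopology)
  have U_mem: "nabla_pt x \<in> U x" if "x \<in> A" for x
    using that near_refl by (simp add: U_def)
  \<comment> \<open>The height of a basic neighbourhood inside the assigned set becomes the value of
    \<open>F\<close> at \<open>x\<close>.\<close>
  have "\<exists>h. nbhd h x \<inter> nabla_pt ` A \<subseteq> G (nabla_pt x) (U x)" if x: "x \<in> A" for x
  proof -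
    have "openin (nabla_sub A) (G (nabla_pt x) (U x))" "nabla_pt x \<in> G (nabla_pt x) (U x)"
      using G[rule_format, OF _ conjI[OF U_open U_mem]] x by auto
    then obtain W where "openin nabla_space W" "G (nabla_pt x) (U x) = W \<inter> nabla_pt ` A"
      "nabla_pt x \<in> W"
      by (auto simp: nabla_sub_def openin_subtopology)
    then show ?thesis
      using openin_nabla_space_contains_nbhd by (metis Int_mono order_refl)
  qed
  then obtain F where F: "\<And>x. x \<in> A \<Longrightarrow> nbhd (F x) x \<inter> nabla_pt ` A \<subseteq> G (nabla_pt x) (U x)"
    by metis
  have "\<not> gt_star (pdiff x y) (F y) \<or> \<not> gt_star (pdiff y x) (F x)"
    if xy: "x \<in> A" "y \<in> A" and sw: "switches x y" for x y
  proof (rule ccontr)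
    assume "\<not> ?thesis"
    then have gt: "\<forall>\<^sub>F n in cofinite. x n = y n \<or> x n = None \<or> F y n < the (x n)"
      "\<forall>\<^sub>F n in cofinite. y n = x n \<or> y n = None \<or> F x n < the (y n)"
      by (simp_all add: gt_star_pdiff_cofinite)
    have sub: "\<not> (\<forall>\<^sub>F n in cofinite. x n = y n \<or> x n = None)"
      "\<not> (\<forall>\<^sub>F n in cofinite. y n = x n \<or> y n = None)"
      and agree: "\<forall>\<^sub>F n in cofinite. x n = None \<or> y n = None \<or> x n = y n"
      using sw by (simp_all add: switches_cofinite)
    \<comment> \<open>The union of the two functions bounds both from below. As \<open>++\<close>
      prefers \<open>y\<close>, the comparison with \<open>x\<close> rests on
      \<open>agree\<close>.\<close>
    have le_x: "nabla_le (nabla_pt (x ++ y)) (nabla_pt x)"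
      unfolding nabla_le_cofinite using agree
      by eventually_elim (auto simp: map_add_def split: option.splits)
    have le_y: "nabla_le (nabla_pt (x ++ y)) (nabla_pt y)"
      unfolding nabla_le_cofinite
      by (rule always_eventually) (auto simp: map_add_def split: option.splits)
    have xy_top: "nabla_pt (x ++ y) \<in> topspace nabla_space"
      by (simp flip: range_nabla_pt)
    then have comp: "nabla_compatible (nabla_pt x) (nabla_pt y)"
      using le_x le_y by (auto simp: nabla_compatible_def)
    then obtain z where z: "z \<in> A" "nabla_meet (nabla_pt x) (nabla_pt y) = nabla_pt z"
      using meet xy by blast
    have "is_nabla_meet (nabla_pt x) (nabla_pt y) (nabla_pt z)"
      using is_nabla_meet_nabla_meet[OF comp] z(2) by simp
    then have "nabla_le (nabla_pt z) (nabla_pt x)" "nabla_le (nabla_pt z) (nabla_pt y)"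
      "nabla_le (nabla_pt (x ++ y)) (nabla_pt z)"
      using le_x le_y xy_top by (simp_all add: is_nabla_meet_def)
    then have le: "\<forall>\<^sub>F n in cofinite. x n = None \<or> z n = x n"
      "\<forall>\<^sub>F n in cofinite. y n = None \<or> z n = y n"
      "\<forall>\<^sub>F n in cofinite. z n = None \<or> (x ++ y) n = z n"
      by (simp_all only: nabla_le_cofinite)
    have map_add_eq: "(x ++ y) n = (if y n = None then x n else y n)" for n
      by (simp add: map_add_def split: option.split)
    \<comment> \<open>Almost every value of \<open>z\<close> comes from \<open>x ++ y\<close>, so
      outside \<open>dom x\<close> it is a value of \<open>y\<close> and exceeds \<open>F x\<close>
      by the assumed failure.\<close>
    have "near (F x) x z"
      unfolding near_def using le gt(2)
    proof eventually_elim
      case (elim n)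
      then show ?case by (metis map_add_eq)
    qed
    moreover have "near (F y) y z"
      unfolding near_def using le gt(1)
    proof eventually_elim
      case (elim n)
      then show ?case by (metis map_add_eq)
    qed
    ultimately have "nabla_pt z \<in> G (nabla_pt x) (U x) \<inter> G (nabla_pt y) (U y)"
      using F xy z(1) by (auto simp: subset_iff)
    then have "nabla_pt x \<in> U y \<or> nabla_pt y \<in> U x"
      using G_meet[rule_format, of "nabla_pt x" "nabla_pt y" "U x" "U y"] U_open U_mem xy by auto
    then have "near (\<lambda>_. 0) y x \<or> near (\<lambda>_. 0) x y"
      by (auto simp: U_def)
    then show False
    proof
      assume "near (\<lambda>_. 0) y x"
      then have "\<forall>\<^sub>F n in cofinite. y n = x n \<or> y n = None"
        unfolding near_def by eventually_elim auto
      with sub(2) show False ..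
    next
      assume "near (\<lambda>_. 0) x y"
      then have "\<forall>\<^sub>F n in cofinite. x n = y n \<or> x n = None"
        unfolding near_def by eventually_elim auto
      with sub(1) show False ..
    qed
  qed
  then show ?thesis
    unfolding Delta_def by blast
qed

theorem theorem20:
  fixes A :: "(nat \<rightharpoonup> nat) set"
  shows "(Delta A \<longrightarrow>
            monotonically_normal_space (nabla_sub A) \<and> hereditarily_paracompact_space (nabla_sub A)) \<and>
         (monotonically_normal_space (nabla_sub A) \<and>
          (\<forall>c\<in>nabla_pt ` A. \<forall>d\<in>nabla_pt ` A.
             nabla_compatible c d \<longrightarrow> nabla_meet c d \<in> nabla_pt ` A) \<longrightarrow>
          Delta A)"
  using Delta_imp_monotonically_normal Delta_imp_hereditarily_paracompact
    monotonically_normal_imp_Delta by blast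

end
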